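(* The small subshift $\bigcap_\xi\Sigma_\xi$ (intersection over all orderings $\xi$ of the Pascal graph) consists of only the two fixed points $a^\infty$ and $b^\infty$ and the shift orbits of the points $a^\infty.ba^\infty$ and $b^\infty.ab^\infty$.
   Context: The Pascal graph has vertex set $\mathscr V=\{(x,y):x,y\in\mathbb Z_{\ge0}\}$ and, for each $(x,y)\in\mathscr V$, one directed edge from $(x,y)$ to $(x+1,y)$ and one to $(x,y+1)$. The root is $(0,0)$. An ordering is a function $\xi:\mathscr V\to\{0,1\}$: for $x,y\ge1$ the edge from $(x-1,y)$ to $(x,y)$ is less than the edge from $(x,y-1)$ to $(x,y)$ if and only if $\xi(x,y)=1$ (the values of $\xi$ at vertices with $x=0$ or $y=0$ play no role; the unique edge entering such a non-root vertex is both minimal and maximal). $X$ is the set of infinite directed paths starting at the root. Distinct paths $\gamma,\eta$ that eventually coincide are compared by $\gamma<\eta$ iff $\gamma_n<\eta_n$, where $n$ is the largest index with $\gamma_n\ne\eta_n$. For a path $\gamma$ not consisting entirely of maximal edges, $T_\xi\gamma$ is the smallest path larger than $\gamma$; $T_\xi^{-1}$ is defined on paths not consisting entirely of minimal edges. The $1$-coding of $\gamma\in X$ is the (possibly one-sided or finite) sequence over $\{a,b\}$ whose $n$-th entry, whenever $T_\xi^n\gamma$ is defined ($n\in\mathbb Z$), is $a$ if the first edge of $T_\xi^n\gamma$ goes from $(0,0)$ to $(1,0)$ and $b$ if it goes to $(0,1)$. For an ordering $\xi$, $\Sigma_\xi\subset\{a,b\}^{\mathbb Z}$ is the set of all two-sided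 sequences each of whose finite subblocks can be found in the $1$-coding (for $\xi$) of some $\gamma\in X$. Here $a^\infty$, $b^\infty$ also denote the constant two-sided sequences; $a^\infty.ba^\infty$ is the two-sided sequence with $b$ at coordinate $0$ and $a$ at all other coordinates, and $b^\infty.ab^\infty$ is the sequence with $a$ at coordinate $0$ and $b$ elsewhere. *)

theory Defs
  imports Main
begin

type_synonym vertex = "nat \<times> nat"
type_synonym edge = "vertex \<times> vertex"

text \<open>An edge is the pair of its source and its target; the Pascal graph has no multiple edges.\<close>

definition pascal_edges :: "edge set" where
  "pascal_edges = {((x, y), (x + 1, y)) | x y. True} \<union> {((x, y), (x, y + 1)) | x y. True}"

text \<open>A path is the sequence of its edges, numbered from 0.\<close>

type_synonym path = "nat \<Rightarrow> edge"

definition paths :: "path set" where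
  "paths = {\<gamma>. fst (\<gamma> 0) = (0, 0) \<and> (\<forall>n. \<gamma> n \<in> pascal_edges \<and> snd (\<gamma> n) = fst (\<gamma> (Suc n)))}"

text \<open>The value \<open>True\<close> of an ordering stands for 1, and \<open>False\<close> for 0.\<close>

type_synonym ordering = "vertex \<Rightarrow> bool"

text \<open>Only edges with a common target (necessarily off the axes) are comparable.\<close>

definition edge_less :: "ordering \<Rightarrow> edge \<Rightarrow> edge \<Rightarrow> bool" where
  "edge_less \<xi> e f \<longleftrightarrow> (\<exists>x\<ge>1. \<exists>y\<ge>1.
     (\<xi> (x, y) \<and> e = ((x - 1, y), (x, y)) \<and> f = ((x, y - 1), (x, y))) \<or>
     (\<not> \<xi> (x, y) \<and> e = ((x, y - 1), (x, y)) \<and> f = ((x - 1, y), (x, y))))"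

definition maximal_edge :: "ordering \<Rightarrow> edge \<Rightarrow> bool" where
  "maximal_edge \<xi> e \<longleftrightarrow> e \<in> pascal_edges \<and> (\<nexists>f. f \<in> pascal_edges \<and> edge_less \<xi> e f)"

definition minimal_edge :: "ordering \<Rightarrow> edge \<Rightarrow> bool" where
  "minimal_edge \<xi> e \<longleftrightarrow> e \<in> pascal_edges \<and> (\<nexists>f. f \<in> pascal_edges \<and> edge_less \<xi> f e)"

definition path_less :: "ordering \<Rightarrow> path \<Rightarrow> path \<Rightarrow> bool" where
  "path_less \<xi> \<gamma> \<eta> \<longleftrightarrow>
     (\<exists>n. \<gamma> n \<noteq> \<eta> n \<and> (\<forall>m>n. \<gamma> m = \<eta> m) \<and> edge_less \<xi> (\<gamma> n) (\<eta> n))"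

text \<open>The partial maps \<open>T\<^sub>\<xi>\<close> and its inverse; \<open>None\<close> means undefined.\<close>

definition adic :: "ordering \<Rightarrow> path \<Rightarrow> path option" where
  "adic \<xi> \<gamma> =
     (if \<forall>n. maximal_edge \<xi> (\<gamma> n) then None
      else Some (THE \<eta>. \<eta> \<in> paths \<and> path_less \<xi> \<gamma> \<eta> \<and>
             (\<forall>\<zeta>\<in>paths. path_less \<xi> \<gamma> \<zeta> \<longrightarrow> \<zeta> = \<eta> \<or> path_less \<xi> \<eta> \<zeta>)))"

definition adic_inv :: "ordering \<Rightarrow> path \<Rightarrow> path option" where
  "adic_inv \<xi> \<gamma> =
     (if \<forall>n. minimal_edge \<xi> (\<gamma> n) then None
      else Some (THE \<eta>. \<eta> \<in> paths \<and> adic \<xi> \<eta> = Some \<gamma>))"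

definition adic_power :: "ordering \<Rightarrow> int \<Rightarrow> path \<Rightarrow> path option" where
  "adic_power \<xi> n \<gamma> =
     (if n \<ge> 0 then ((\<lambda>p. Option.bind p (adic \<xi>)) ^^ nat n) (Some \<gamma>)
      else ((\<lambda>p. Option.bind p (adic_inv \<xi>)) ^^ nat (- n)) (Some \<gamma>))"

datatype letter = a | b

definition first_letter :: "path \<Rightarrow> letter" where
  "first_letter \<gamma> = (if \<gamma> 0 = ((0, 0), (1, 0)) then a else b)"

definition one_coding :: "ordering \<Rightarrow> path \<Rightarrow> int \<Rightarrow> letter option" where
  "one_coding \<xi> \<gamma> n = map_option first_letter (adic_power \<xi> n \<gamma>)"

text \<open>The two-sided sequences \<open>s\<close> each of whose finite blocks \<open>s i, \<dots>, s (i + l - 1)\<close> occurs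
  at some position \<open>k\<close> of the 1-coding of some path.\<close>

definition Sigma_shift :: "ordering \<Rightarrow> (int \<Rightarrow> letter) set" where
  "Sigma_shift \<xi> = {s. \<forall>i. \<forall>l::nat. \<exists>\<gamma>\<in>paths. \<exists>k.
     \<forall>j<l. one_coding \<xi> \<gamma> (k + int j) = Some (s (i + int j))}"

definition shift_orbit :: "(int \<Rightarrow> letter) \<Rightarrow> (int \<Rightarrow> letter) set" where
  "shift_orbit s = {(\<lambda>i. s (i + k)) | k::int. True}"

end

theory Submission
  imports Defs "HOL-Library.Sublist"
begin

text \<open>
  Reading the first letters of the finite paths from the root to \<open>(x, y)\<close> in increasing order gives a word
  \<open>block \<xi> x y\<close>, and listing the paths by their last edge shows that it is one of the two
  concatenations of \<open>block \<xi> (x - 1) y\<close> and \<open>block \<xi> x (y - 1)\<close>, the order being given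
  by \<open>\<xi> (x, y)\<close>. All paths of a finite stretch of an orbit eventually coincide, so the stretch is coded
  by a factor of one block; conversely the paths with a common tail are successive images under the adic map. Hence a
  sequence belongs to \<open>Sigma_shift \<xi>\<close> iff each of its finite words is a factor of some block
  (\<open>Sigma_shift_iff\<close>), and the rest is combinatorics of words.

  For the inclusion from left to right two orderings suffice, the constant ones. They are exchanged by swapping the two
  letters and the two axes (\<open>block_flip\<close>), so it is enough to study \<open>\<xi> = 1\<close> and to apply
  the result both to a sequence and to its flip. For \<open>\<xi> = 1\<close> a block that is not on an axis is a
  product in which the left factor ends with \<open>b a\<^bsup>x-1\<^esup>\<close> and the right factor begins with
  \<open>b\<^bsup>y-1\<^esup> a\<close>. So the two runs that meet at the seam determine the vertex, and this excludes
  the words \<open>bbaa\<close>, \<open>aababb\<close> and \<open>a\<^sup>n b a\<^sup>n b a\<close> for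
  \<open>n > 0\<close>. A sequence that avoids these words and their flips does not contain both \<open>aa\<close> and
  \<open>bb\<close> (\<open>no_aa_or_no_bb\<close>). If it does not contain \<open>bb\<close>, then it has at most one
  \<open>b\<close>: two successive \<open>b\<close> at the smallest occurring distance \<open>n + 1\<close> would be
  preceded by \<open>a\<^sup>n\<close> and followed by \<open>a\<close>, which gives
  \<open>a\<^sup>n b a\<^sup>n b a\<close> (\<open>isolated_b_unique\<close>).

  For the other inclusion the word \<open>a\<^sup>m b a\<^sup>m\<close> has to be found in some block of an arbitrary
  ordering (\<open>isolated_b_in_block\<close>). The blocks in the row \<open>y = 1\<close> are words
  \<open>a\<^sup>p b a\<^sup>q\<close> in which \<open>p\<close> and \<open>q\<close> never decrease with
  \<open>x = p + q\<close>. Either both exponents reach \<open>m\<close>, or one of them stays below \<open>m\<close>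
  while the other is large; then the product of any two of these words contains \<open>a\<^sup>m b a\<^sup>m\<close>,
  and such a product occurs in the row \<open>y = 2\<close>.
\<close>

section \<open>Words and path classes at the vertices\<close>

text \<open>The clause for the root makes swapping the letters and the axes an exact symmetry.\<close>
fun block :: "ordering \<Rightarrow> nat \<Rightarrow> nat \<Rightarrow> letter list" where
  "block \<xi> 0 0 = []"
| "block \<xi> (Suc x) 0 = [a]"
| "block \<xi> 0 (Suc y) = [b]"
| "block \<xi> (Suc x) (Suc y) =
     (if \<xi> (Suc x, Suc y) then block \<xi> x (Suc y) @ block \<xi> (Suc x) y
      else block \<xi> (Suc x) y @ block \<xi> x (Suc y))"

text \<open>The paths through \<open>(x, y)\<close> with a prescribed continuation, in increasing order. The recursion
  prescribes one more edge at a time, going backwards from \<open>(x, y)\<close>, so that its leaves are whole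
  paths and no finite path has to be spliced to a tail.\<close>
fun tail_class :: "ordering \<Rightarrow> nat \<Rightarrow> nat \<Rightarrow> path \<Rightarrow> path list" where
  "tail_class \<xi> 0 0 \<gamma> = [\<gamma>]"
| "tail_class \<xi> (Suc x) 0 \<gamma> = tail_class \<xi> x 0 (\<gamma>(x := ((x, 0), (Suc x, 0))))"
| "tail_class \<xi> 0 (Suc y) \<gamma> = tail_class \<xi> 0 y (\<gamma>(y := ((0, y), (0, Suc y))))"
| "tail_class \<xi> (Suc x) (Suc y) \<gamma> =
     (let A = tail_class \<xi> x (Suc y) (\<gamma>(Suc (x + y) := ((x, Suc y), (Suc x, Suc y))));
          C = tail_class \<xi> (Suc x) y (\<gamma>(Suc (x + y) := ((Suc x, y), (Suc x, Suc y))))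
      in if \<xi> (Suc x, Suc y) then A @ C else C @ A)"

lemma map_first_letter_tail_class:
  "(x, y) \<noteq> (0, 0) \<Longrightarrow> map first_letter (tail_class \<xi> x y \<gamma>) = block \<xi> x y"
proof (induction \<xi> x y \<gamma> rule: tail_class.induct)
  case (2 \<xi> x \<gamma>)
  show ?case
  proof (cases x)
    case 0 then show ?thesis by (simp add: first_letter_def)
  next
    case (Suc x') with 2 show ?thesis by (simp only: tail_class.simps) simp
  qed
next
  case (3 \<xi> y \<gamma>)
  show ?case
  proof (cases y)
    case 0 then show ?thesis by (simp add: first_letter_def)
  next
    case (Suc y') with 3 show ?thesis by (simp only: tail_class.simps) simp
  qed
qed (auto simp: Let_def)

lemma tail_class_nonempty: "tail_class \<xi> x y \<gamma> \<noteq> []"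
  by (induction \<xi> x y \<gamma> rule: tail_class.induct) (auto simp: Let_def fun_upd_def)

text \<open>What \<open>tail_class\<close> expects of \<open>\<gamma>\<close>: a path from \<open>(x, y)\<close> on, whose initial part the recursion
  overwrites.\<close>
definition tail_from :: "nat \<Rightarrow> nat \<Rightarrow> path \<Rightarrow> bool" where
  "tail_from x y \<gamma> \<longleftrightarrow> fst (\<gamma> (x + y)) = (x, y) \<and>
     (\<forall>n\<ge>x + y. \<gamma> n \<in> pascal_edges \<and> snd (\<gamma> n) = fst (\<gamma> (Suc n)))"

lemma tail_from_upd:
  assumes "tail_from x' y' \<gamma>" and "((x, y), (x', y')) \<in> pascal_edges" and "n = x + y"
  shows "tail_from x y (\<gamma>(n := ((x, y), (x', y'))))"
proof -
  have "x' + y' = Suc (x + y)" using assms(2) by (auto simp: pascal_edges_def)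
  with assms show ?thesis unfolding tail_from_def by auto
qed

lemma edges_into:
  "{e \<in> pascal_edges. snd e = (Suc x, 0)} = {((x, 0), (Suc x, 0))}"
  "{e \<in> pascal_edges. snd e = (0, Suc y)} = {((0, y), (0, Suc y))}"
  "{e \<in> pascal_edges. snd e = (Suc x, Suc y)} =
     {((x, Suc y), (Suc x, Suc y)), ((Suc x, y), (Suc x, Suc y))}"
  by (auto simp: pascal_edges_def)

definition agreeing :: "path \<Rightarrow> nat \<Rightarrow> path set" where
  "agreeing \<gamma> n = {\<eta> \<in> paths. \<forall>m\<ge>n. \<eta> m = \<gamma> m}"

text \<open>The class with a given tail splits according to the last edge before that tail; this is the recursion
  behind \<open>tail_class\<close>.\<close>
lemma agreeing_Suc:
  assumes "fst (\<gamma> (Suc n)) = v"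
  shows "agreeing \<gamma> (Suc n) = (\<Union>e\<in>{e \<in> pascal_edges. snd e = v}. agreeing (\<gamma>(n := e)) n)"
proof (intro equalityI subsetI)
  fix \<eta> assume "\<eta> \<in> agreeing \<gamma> (Suc n)"
  then have \<eta>: "\<eta> \<in> paths" "\<forall>m\<ge>Suc n. \<eta> m = \<gamma> m" by (auto simp: agreeing_def)
  then have "\<eta> n \<in> pascal_edges" "snd (\<eta> n) = v" using assms by (auto simp: paths_def)
  moreover have "\<eta> \<in> agreeing (\<gamma>(n := \<eta> n)) n"
    using \<eta> by (auto simp: agreeing_def Suc_le_eq)
  ultimately show "\<eta> \<in> (\<Union>e\<in>{e \<in> pascal_edges. snd e = v}. agreeing (\<gamma>(n := e)) n)" by blast
qed (auto simp: agreeing_def)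

lemma set_tail_class: "tail_from x y \<gamma> \<Longrightarrow> set (tail_class \<xi> x y \<gamma>) = agreeing \<gamma> (x + y)"
proof (induction \<xi> x y \<gamma> rule: tail_class.induct)
  case (1 \<xi> \<gamma>)
  then have "\<gamma> \<in> paths" by (auto simp: tail_from_def paths_def)
  then have "agreeing \<gamma> 0 = {\<gamma>}" unfolding agreeing_def by (auto intro!: ext)
  then show ?case by simp
next
  case (2 \<xi> x \<gamma>)
  have 1: "tail_from x 0 (\<gamma>(x := ((x, 0), (Suc x, 0))))"
    using 2(2) by (rule tail_from_upd) (auto simp: pascal_edges_def)
  have "fst (\<gamma> (Suc x)) = (Suc x, 0)" using 2(2) by (simp add: tail_from_def)
  from agreeing_Suc[of \<gamma> x, OF this] 2(1)[OF 1] show ?case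
    by (simp only: edges_into) (simp add: fun_upd_def)
next
  case (3 \<xi> y \<gamma>)
  have 1: "tail_from 0 y (\<gamma>(y := ((0, y), (0, Suc y))))"
    using 3(2) by (rule tail_from_upd) (auto simp: pascal_edges_def)
  have "fst (\<gamma> (Suc y)) = (0, Suc y)" using 3(2) by (simp add: tail_from_def)
  from agreeing_Suc[of \<gamma> y, OF this] 3(1)[OF 1] show ?case
    by (simp only: edges_into) (simp add: fun_upd_def)
next
  case (4 \<xi> x y \<gamma>)
  have 1: "tail_from x (Suc y) (\<gamma>(Suc (x + y) := ((x, Suc y), (Suc x, Suc y))))"
    using 4(3) by (rule tail_from_upd) (auto simp: pascal_edges_def)
  have 2: "tail_from (Suc x) y (\<gamma>(Suc (x + y) := ((Suc x, y), (Suc x, Suc y))))"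
    using 4(3) by (rule tail_from_upd) (auto simp: pascal_edges_def)
  have "fst (\<gamma> (Suc (Suc (x + y)))) = (Suc x, Suc y)" using 4(3) by (simp add: tail_from_def)
  from agreeing_Suc[of \<gamma> "Suc (x + y)", OF this] 4(1)[OF 1] 4(2)[OF refl 2] show ?case
    by (simp only: edges_into tail_class.simps Let_def) (simp add: fun_upd_def Un_commute)
qed

lemma tail_from_agreeing_nonempty: "tail_from x y \<gamma> \<Longrightarrow> \<exists>\<eta>. \<eta> \<in> agreeing \<gamma> (x + y)"
  using set_tail_class[of x y \<gamma> "\<lambda>_. True"] tail_class_nonempty[of "\<lambda>_. True" x y \<gamma>]
  by (metis all_not_in_conv set_empty)

section \<open>The adic map as the successor in a path class\<close>

lemma edge_less_asym: "edge_less \<xi> e f \<Longrightarrow> \<not> edge_less \<xi> f e"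
  by (auto simp: edge_less_def)

lemma edge_less_irrefl: "\<not> edge_less \<xi> e e"
  using edge_less_asym by blast

lemma edge_less_snd: "edge_less \<xi> e f \<Longrightarrow> snd e = snd f"
  by (auto simp: edge_less_def)

lemma path_less_asym: "path_less \<xi> \<gamma> \<eta> \<Longrightarrow> \<not> path_less \<xi> \<eta> \<gamma>"
  unfolding path_less_def by (metis edge_less_asym linorder_neqE_nat)

lemma path_less_irrefl: "\<not> path_less \<xi> \<gamma> \<gamma>"
  using path_less_asym by blast

text \<open>Two paths in different halves of the list differ last at the edge entering \<open>(x, y)\<close>, so this
  edge decides the comparison, and the halves are arranged accordingly.\<close>
lemma sorted_tail_class: "tail_from x y \<gamma> \<Longrightarrow> sorted_wrt (path_less \<xi>) (tail_class \<xi> x y \<gamma>)"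
proof (induction \<xi> x y \<gamma> rule: tail_class.induct)
  case (2 \<xi> x \<gamma>)
  have "tail_from x 0 (\<gamma>(x := ((x, 0), (Suc x, 0))))"
    using 2(2) by (rule tail_from_upd) (auto simp: pascal_edges_def)
  from 2(1)[OF this] show ?case by (simp add: fun_upd_def)
next
  case (3 \<xi> y \<gamma>)
  have "tail_from 0 y (\<gamma>(y := ((0, y), (0, Suc y))))"
    using 3(2) by (rule tail_from_upd) (auto simp: pascal_edges_def)
  from 3(1)[OF this] show ?case by (simp add: fun_upd_def)
next
  case (4 \<xi> x y \<gamma>)
  let ?e = "((x, Suc y), (Suc x, Suc y))" and ?f = "((Suc x, y), (Suc x, Suc y))"
  let ?n = "Suc (x + y)"
  have 1: "tail_from x (Suc y) (\<gamma>(?n := ?e))"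
    using 4(3) by (rule tail_from_upd) (auto simp: pascal_edges_def)
  have 2: "tail_from (Suc x) y (\<gamma>(?n := ?f))"
    using 4(3) by (rule tail_from_upd) (auto simp: pascal_edges_def)
  have less: "path_less \<xi> \<eta> \<zeta>"
    if "\<eta> \<in> agreeing (\<gamma>(?n := e)) ?n" "\<zeta> \<in> agreeing (\<gamma>(?n := f)) ?n" "edge_less \<xi> e f"
    for \<eta> \<zeta> e f
    unfolding path_less_def
  proof (intro exI[of _ ?n] conjI allI impI)
    show "\<eta> ?n \<noteq> \<zeta> ?n" "edge_less \<xi> (\<eta> ?n) (\<zeta> ?n)"
      using that by (auto simp: agreeing_def edge_less_irrefl)
    fix m assume "?n < m"
    then show "\<eta> m = \<zeta> m" using that by (auto simp: agreeing_def)
  qed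
  have ef: "if \<xi> (Suc x, Suc y) then edge_less \<xi> ?e ?f else edge_less \<xi> ?f ?e"
    unfolding edge_less_def by (cases "\<xi> (Suc x, Suc y)", simp_all only: if_True if_False)
      (intro exI[of _ "Suc x"] exI[of _ "Suc y"] conjI; simp)+
  show ?case using 4(1)[OF 1] 4(2)[OF refl 2] set_tail_class[OF 1] set_tail_class[OF 2] ef
    by (auto simp: Let_def sorted_wrt_append fun_upd_def intro!: less)
qed auto

lemma path_level: "\<gamma> \<in> paths \<Longrightarrow> fst (fst (\<gamma> n)) + snd (fst (\<gamma> n)) = n"
proof (induction n)
  case 0 then show ?case by (simp add: paths_def)
next
  case (Suc n)
  then have "\<gamma> n \<in> pascal_edges" "snd (\<gamma> n) = fst (\<gamma> (Suc n))" by (auto simp: paths_def)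
  with Suc show ?case unfolding pascal_edges_def by (elim UnE CollectE exE conjE)
      (metis Suc_eq_plus1 add_Suc add_Suc_right fst_conv snd_conv)+
qed

definition class_list :: "ordering \<Rightarrow> path \<Rightarrow> nat \<Rightarrow> path list" where
  "class_list \<xi> \<gamma> n = tail_class \<xi> (fst (fst (\<gamma> n))) (snd (fst (\<gamma> n))) \<gamma>"

lemma path_tail_from: "\<gamma> \<in> paths \<Longrightarrow> tail_from (fst (fst (\<gamma> n))) (snd (fst (\<gamma> n))) \<gamma>"
  by (simp add: tail_from_def path_level) (simp add: paths_def)

lemma set_class_list: "\<gamma> \<in> paths \<Longrightarrow> set (class_list \<xi> \<gamma> n) = agreeing \<gamma> n"
  by (simp add: class_list_def set_tail_class path_tail_from path_level)

lemma sorted_class_list: "\<gamma> \<in> paths \<Longrightarrow> sorted_wrt (path_less \<xi>) (class_list \<xi> \<gamma> n)"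
  by (simp add: class_list_def sorted_tail_class path_tail_from)

lemma class_list_less_iff:
  assumes "\<gamma> \<in> paths" "i < length (class_list \<xi> \<gamma> n)" "j < length (class_list \<xi> \<gamma> n)"
  shows "path_less \<xi> (class_list \<xi> \<gamma> n ! i) (class_list \<xi> \<gamma> n ! j) \<longleftrightarrow> i < j"
  using sorted_wrt_nth_less[OF sorted_class_list[OF assms(1), of \<xi> n]] assms(2,3)
  by (metis linorder_neqE_nat path_less_asym path_less_irrefl)

lemma class_list_inject:
  assumes "\<gamma> \<in> paths" "i < length (class_list \<xi> \<gamma> n)" "j < length (class_list \<xi> \<gamma> n)"
    and "class_list \<xi> \<gamma> n ! i = class_list \<xi> \<gamma> n ! j"
  shows "i = j"
  using assms class_list_less_iff path_less_irrefl by (metis linorder_neqE_nat)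

lemma class_list_nth_mem:
  "\<gamma> \<in> paths \<Longrightarrow> i < length (class_list \<xi> \<gamma> n) \<Longrightarrow> class_list \<xi> \<gamma> n ! i \<in> agreeing \<gamma> n"
  using set_class_list nth_mem by blast

text \<open>A larger path outside the class differs from all members of the class at the same last index, hence is also
  larger than the next member. So the next member is the least larger path overall.\<close>
lemma adic_nth:
  assumes \<gamma>: "\<gamma> \<in> paths" and i: "Suc i < length (class_list \<xi> \<gamma> n)"
  shows "adic \<xi> (class_list \<xi> \<gamma> n ! i) = Some (class_list \<xi> \<gamma> n ! Suc i)"
proof -
  let ?xs = "class_list \<xi> \<gamma> n"
  let ?\<eta> = "?xs ! i" and ?\<theta> = "?xs ! Suc i"
  have less: "path_less \<xi> ?\<eta> ?\<theta>" using class_list_less_iff[OF \<gamma>] i by simp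
  have mem: "?\<eta> \<in> agreeing \<gamma> n" "?\<theta> \<in> agreeing \<gamma> n"
    using class_list_nth_mem[OF \<gamma>] i by simp_all
  from less obtain k where "edge_less \<xi> (?\<eta> k) (?\<theta> k)" unfolding path_less_def by blast
  moreover have "?\<theta> k \<in> pascal_edges" using mem by (auto simp: agreeing_def paths_def)
  ultimately have "\<not> maximal_edge \<xi> (?\<eta> k)" unfolding maximal_edge_def by blast
  moreover have least: "\<zeta> = ?\<theta> \<or> path_less \<xi> ?\<theta> \<zeta>"
    if \<zeta>: "\<zeta> \<in> paths" "path_less \<xi> ?\<eta> \<zeta>" for \<zeta>
  proof (cases "\<zeta> \<in> agreeing \<gamma> n")
    case True
    then obtain j where j: "j < length ?xs" "\<zeta> = ?xs ! j"
      using set_class_list[OF \<gamma>] by (metis in_set_conv_nth)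
    with \<zeta> i have "i < j" using class_list_less_iff[OF \<gamma>] by auto
    then show ?thesis using j i class_list_less_iff[OF \<gamma>] by (cases "j = Suc i") auto
  next
    case False
    from \<zeta>(2) obtain k where k: "?\<eta> k \<noteq> \<zeta> k" "\<forall>m>k. ?\<eta> m = \<zeta> m" "edge_less \<xi> (?\<eta> k) (\<zeta> k)"
      unfolding path_less_def by blast
    have same: "\<forall>m\<ge>n. ?\<eta> m = \<gamma> m" "\<forall>m\<ge>n. ?\<theta> m = \<gamma> m" using mem by (auto simp: agreeing_def)
    have "k \<ge> n"
    proof (rule ccontr)
      assume "\<not> k \<ge> n"
      then have "\<forall>m\<ge>n. \<zeta> m = \<gamma> m" using k(2) same(1) by auto
      with False \<zeta>(1) show False by (simp add: agreeing_def)
    qed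
    then have "path_less \<xi> ?\<theta> \<zeta>" unfolding path_less_def
      using k same by (intro exI[of _ k]) auto
    then show ?thesis ..
  qed
  moreover have "?\<theta> \<in> paths" using mem by (simp add: agreeing_def)
  then have "(THE \<theta>. \<theta> \<in> paths \<and> path_less \<xi> ?\<eta> \<theta> \<and>
             (\<forall>\<zeta>\<in>paths. path_less \<xi> ?\<eta> \<zeta> \<longrightarrow> \<zeta> = \<theta> \<or> path_less \<xi> \<theta> \<zeta>)) = ?\<theta>"
    using less least path_less_asym by (intro the_equality) metis+
  ultimately show ?thesis unfolding adic_def by auto
qed

text \<open>An edge that competes with an edge of a path can replace it: this turns a non-maximal or non-minimal edge
  into a comparable path.\<close>
lemma exists_path_through:
  assumes "\<eta> \<in> paths" "f \<in> pascal_edges" "snd f = snd (\<eta> k)"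
  shows "\<exists>\<theta>\<in>paths. \<theta> k = f \<and> (\<forall>m>k. \<theta> m = \<eta> m)"
proof -
  obtain u v u' v' where f: "f = ((u, v), (u', v'))" by (metis surj_pair)
  have 1: "fst (\<eta> (Suc k)) = (u', v')" using assms f by (auto simp: paths_def)
  then have k: "u + v = k" using path_level[OF assms(1), of "Suc k"] assms(2) f
    by (auto simp: pascal_edges_def)
  have "tail_from u v (\<eta>(k := f))" unfolding f
    using path_tail_from[OF assms(1), of "Suc k"] 1 assms(2) f k by (intro tail_from_upd) auto
  then obtain \<theta> where "\<theta> \<in> agreeing (\<eta>(k := f)) k"
    using tail_from_agreeing_nonempty k by blast
  then show ?thesis by (intro bexI[of _ \<theta>]) (auto simp: agreeing_def)
qed

lemma path_less_nth:
  assumes \<gamma>: "\<gamma> \<in> paths" and "\<eta> \<in> agreeing \<gamma> n" "\<theta> \<in> agreeing \<gamma> n" "path_less \<xi> \<eta> \<theta>"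
  obtains i j where "i < j" "j < length (class_list \<xi> \<gamma> n)"
    "class_list \<xi> \<gamma> n ! i = \<eta>" "class_list \<xi> \<gamma> n ! j = \<theta>"
proof -
  obtain i j where "i < length (class_list \<xi> \<gamma> n)" "class_list \<xi> \<gamma> n ! i = \<eta>"
    "j < length (class_list \<xi> \<gamma> n)" "class_list \<xi> \<gamma> n ! j = \<theta>"
    using assms set_class_list[OF \<gamma>, of \<xi> n] by (metis in_set_conv_nth)
  then show ?thesis using that class_list_less_iff[OF \<gamma>] assms(4) by blast
qed

text \<open>A path with a non-maximal edge is not last in its class once the class is taken beyond that edge, so its
  image is the next entry there.\<close>
lemma adic_SomeD:
  assumes \<gamma>: "\<gamma> \<in> paths" and \<eta>: "\<eta> \<in> agreeing \<gamma> n0" and ad: "adic \<xi> \<eta> = Some \<zeta>"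
  shows "\<exists>N. \<forall>n\<ge>N. \<exists>i. Suc i < length (class_list \<xi> \<gamma> n) \<and>
    class_list \<xi> \<gamma> n ! i = \<eta> \<and> class_list \<xi> \<gamma> n ! Suc i = \<zeta>"
proof -
  have \<eta>p: "\<eta> \<in> paths" using \<eta> by (simp add: agreeing_def)
  then have edges: "\<eta> k \<in> pascal_edges" for k by (simp add: paths_def)
  from ad obtain k where "\<not> maximal_edge \<xi> (\<eta> k)"
    unfolding adic_def by (metis option.distinct(1))
  with edges obtain f where f: "f \<in> pascal_edges" "edge_less \<xi> (\<eta> k) f"
    unfolding maximal_edge_def by blast
  have "snd f = snd (\<eta> k)" using edge_less_snd[OF f(2)] by simp
  from exists_path_through[OF \<eta>p f(1) this]
  obtain \<theta> where \<theta>: "\<theta> \<in> paths" "\<theta> k = f" "\<forall>m>k. \<theta> m = \<eta> m" by blast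
  have "\<eta> k \<noteq> f" using f(2) edge_less_irrefl by metis
  then have less: "path_less \<xi> \<eta> \<theta>"
    unfolding path_less_def using f(2) \<theta>(2,3) by (intro exI[of _ k]) simp
  show ?thesis
  proof (rule exI[of _ "n0 + Suc k"], intro allI impI)
    fix n assume n: "n0 + Suc k \<le> n"
    have "\<eta> \<in> agreeing \<gamma> n" "\<theta> \<in> agreeing \<gamma> n"
      using n \<eta> \<theta> by (auto simp: agreeing_def)
    from path_less_nth[OF \<gamma> this less] obtain i j where
      ij: "i < j" "j < length (class_list \<xi> \<gamma> n)" "class_list \<xi> \<gamma> n ! i = \<eta>" by blast
    then show "\<exists>i. Suc i < length (class_list \<xi> \<gamma> n) \<and>
      class_list \<xi> \<gamma> n ! i = \<eta> \<and> class_list \<xi> \<gamma> n ! Suc i = \<zeta>"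
      using adic_nth[OF \<gamma>, of i \<xi> n] ad by (intro exI[of _ i]) auto
  qed
qed

text \<open>Two preimages of one path have a common tail, so both sit just before it in one list. Injectivity makes the
  description in \<open>adic_inv\<close> definite.\<close>
lemma adic_inj:
  assumes "\<zeta>1 \<in> paths" "\<zeta>2 \<in> paths" "adic \<xi> \<zeta>1 = Some \<eta>" "adic \<xi> \<zeta>2 = Some \<eta>"
  shows "\<zeta>1 = \<zeta>2"
proof -
  have ev: "\<exists>N. \<eta> \<in> agreeing \<zeta> N" if "\<zeta> \<in> paths" "adic \<xi> \<zeta> = Some \<eta>" for \<zeta>
  proof -
    have "\<zeta> \<in> agreeing \<zeta> 0" using that by (simp add: agreeing_def)
    from adic_SomeD[OF that(1) this that(2)] obtain N i where
      "Suc i < length (class_list \<xi> \<zeta> N)" "class_list \<xi> \<zeta> N ! Suc i = \<eta>" by blast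
    with class_list_nth_mem[OF that(1)] show ?thesis by metis
  qed
  obtain N1 N2 where N: "\<eta> \<in> agreeing \<zeta>1 N1" "\<eta> \<in> agreeing \<zeta>2 N2"
    using ev[OF assms(1,3)] ev[OF assms(2,4)] by blast
  then have 2: "\<zeta>2 \<in> agreeing \<zeta>1 (N1 + N2)" using assms(2) by (auto simp: agreeing_def) (metis add_leE)
  have 1: "\<zeta>1 \<in> agreeing \<zeta>1 0" using assms(1) by (simp add: agreeing_def)
  obtain M1 where M1: "\<forall>n\<ge>M1. \<exists>i. Suc i < length (class_list \<xi> \<zeta>1 n) \<and>
    class_list \<xi> \<zeta>1 n ! i = \<zeta>1 \<and> class_list \<xi> \<zeta>1 n ! Suc i = \<eta>"
    using adic_SomeD[OF assms(1) 1 assms(3)] by blast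
  obtain M2 where M2: "\<forall>n\<ge>M2. \<exists>i. Suc i < length (class_list \<xi> \<zeta>1 n) \<and>
    class_list \<xi> \<zeta>1 n ! i = \<zeta>2 \<and> class_list \<xi> \<zeta>1 n ! Suc i = \<eta>"
    using adic_SomeD[OF assms(1) 2 assms(4)] by blast
  obtain i where i: "Suc i < length (class_list \<xi> \<zeta>1 (M1 + M2))"
    "class_list \<xi> \<zeta>1 (M1 + M2) ! i = \<zeta>1" "class_list \<xi> \<zeta>1 (M1 + M2) ! Suc i = \<eta>"
    using M1[rule_format, of "M1 + M2"] by auto
  obtain j where j: "Suc j < length (class_list \<xi> \<zeta>1 (M1 + M2))"
    "class_list \<xi> \<zeta>1 (M1 + M2) ! j = \<zeta>2" "class_list \<xi> \<zeta>1 (M1 + M2) ! Suc j = \<eta>"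
    using M2[rule_format, of "M1 + M2"] by auto
  have "Suc i = Suc j" using class_list_inject[OF assms(1) i(1) j(1)] i(3) j(3) by simp
  with i(2) j(2) show ?thesis by simp
qed

lemma adic_inv_SomeD:
  assumes \<gamma>: "\<gamma> \<in> paths" and \<eta>: "\<eta> \<in> agreeing \<gamma> n0" and ad: "adic_inv \<xi> \<eta> = Some \<zeta>"
  shows "\<exists>N. \<forall>n\<ge>N. \<exists>i. Suc i < length (class_list \<xi> \<gamma> n) \<and>
    class_list \<xi> \<gamma> n ! i = \<zeta> \<and> class_list \<xi> \<gamma> n ! Suc i = \<eta>"
proof -
  have \<eta>p: "\<eta> \<in> paths" using \<eta> by (simp add: agreeing_def)
  then have edges: "\<eta> k \<in> pascal_edges" for k by (simp add: paths_def)
  from ad obtain k where "\<not> minimal_edge \<xi> (\<eta> k)"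
    unfolding adic_inv_def by (metis option.distinct(1))
  with edges obtain f where f: "f \<in> pascal_edges" "edge_less \<xi> f (\<eta> k)"
    unfolding minimal_edge_def by blast
  have "snd f = snd (\<eta> k)" using edge_less_snd[OF f(2)] by simp
  from exists_path_through[OF \<eta>p f(1) this]
  obtain \<theta> where \<theta>: "\<theta> \<in> paths" "\<theta> k = f" "\<forall>m>k. \<theta> m = \<eta> m" by blast
  have "\<eta> k \<noteq> f" using f(2) edge_less_irrefl by metis
  then have less: "path_less \<xi> \<theta> \<eta>"
    unfolding path_less_def using f(2) \<theta>(2,3) by (intro exI[of _ k]) simp
  show ?thesis
  proof (rule exI[of _ "n0 + Suc k"], intro allI impI)
    fix n assume n: "n0 + Suc k \<le> n"
    have "\<theta> \<in> agreeing \<gamma> n" "\<eta> \<in> agreeing \<gamma> n"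
      using n \<eta> \<theta> by (auto simp: agreeing_def)
    from path_less_nth[OF \<gamma> this less] obtain i j where
      ij: "i < j" "j < length (class_list \<xi> \<gamma> n)" "class_list \<xi> \<gamma> n ! j = \<eta>" by blast
    define p where "p = j - 1"
    have p: "Suc p < length (class_list \<xi> \<gamma> n)" "class_list \<xi> \<gamma> n ! Suc p = \<eta>"
      using ij by (auto simp: p_def)
    have adp: "adic \<xi> (class_list \<xi> \<gamma> n ! p) = Some \<eta>" using adic_nth[OF \<gamma> p(1)] p(2) by simp
    have pp: "class_list \<xi> \<gamma> n ! p \<in> paths"
      using class_list_nth_mem[OF \<gamma>, of p \<xi> n] p(1) by (simp add: agreeing_def)
    have "(THE \<eta>'. \<eta>' \<in> paths \<and> adic \<xi> \<eta>' = Some \<eta>) = class_list \<xi> \<gamma> n ! p"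
      using adp pp by (intro the_equality) (auto intro: adic_inj)
    then have "\<zeta> = class_list \<xi> \<gamma> n ! p" using ad by (auto simp: adic_inv_def split: if_splits)
    with p show "\<exists>i. Suc i < length (class_list \<xi> \<gamma> n) \<and>
      class_list \<xi> \<gamma> n ! i = \<zeta> \<and> class_list \<xi> \<gamma> n ! Suc i = \<eta>" by blast
  qed
qed

section \<open>Finite words of the coding\<close>

definition displaced :: "ordering \<Rightarrow> path \<Rightarrow> int \<Rightarrow> path \<Rightarrow> nat \<Rightarrow> bool" where
  "displaced \<xi> \<gamma> k \<eta> n \<longleftrightarrow> (\<exists>i j. i < length (class_list \<xi> \<gamma> n) \<and> j < length (class_list \<xi> \<gamma> n) \<and>
     class_list \<xi> \<gamma> n ! i = \<gamma> \<and> class_list \<xi> \<gamma> n ! j = \<eta> \<and> int j = int i + k)"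

lemma displaced_agreeing: "\<gamma> \<in> paths \<Longrightarrow> displaced \<xi> \<gamma> k \<eta> n \<Longrightarrow> \<eta> \<in> agreeing \<gamma> n"
  unfolding displaced_def using class_list_nth_mem by blast

lemma displaced_step:
  assumes \<gamma>: "\<gamma> \<in> paths" and N: "\<forall>n\<ge>N. displaced \<xi> \<gamma> k \<eta> n"
    and M: "\<exists>M. \<forall>n\<ge>M. \<exists>p q. p < length (class_list \<xi> \<gamma> n) \<and> q < length (class_list \<xi> \<gamma> n) \<and>
    class_list \<xi> \<gamma> n ! p = \<eta> \<and> class_list \<xi> \<gamma> n ! q = \<zeta> \<and> int q = int p + d"
  shows "\<exists>N. \<forall>n\<ge>N. displaced \<xi> \<gamma> (k + d) \<zeta> n"
proof -
  from M obtain M where M: "\<And>n. n \<ge> M \<Longrightarrow> \<exists>p q. p < length (class_list \<xi> \<gamma> n) \<and> q < length (class_list \<xi> \<gamma> n) \<and>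
    class_list \<xi> \<gamma> n ! p = \<eta> \<and> class_list \<xi> \<gamma> n ! q = \<zeta> \<and> int q = int p + d" by blast
  show ?thesis
  proof (intro exI[of _ "N + M"] allI impI)
    fix n assume n: "N + M \<le> n"
    obtain i j where ij: "i < length (class_list \<xi> \<gamma> n)" "j < length (class_list \<xi> \<gamma> n)"
     "class_list \<xi> \<gamma> n ! i = \<gamma>" "class_list \<xi> \<gamma> n ! j = \<eta>" "int j = int i + k"
      using N n unfolding displaced_def by (meson add_leD1)
    obtain p q where pq: "p < length (class_list \<xi> \<gamma> n)" "q < length (class_list \<xi> \<gamma> n)"
      "class_list \<xi> \<gamma> n ! p = \<eta>" "class_list \<xi> \<gamma> n ! q = \<zeta>" "int q = int p + d"
      using M[of n] n by auto
    have "p = j" using class_list_inject[OF \<gamma> pq(1) ij(2)] pq ij by simp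
    then show "displaced \<xi> \<gamma> (k + d) \<zeta> n" unfolding displaced_def
      using ij pq by (intro exI[of _ i] exI[of _ q]) auto
  qed
qed

lemma displaced_self: "\<gamma> \<in> paths \<Longrightarrow> displaced \<xi> \<gamma> 0 \<gamma> n"
proof -
  assume \<gamma>: "\<gamma> \<in> paths"
  then have "\<gamma> \<in> set (class_list \<xi> \<gamma> n)" by (simp add: set_class_list agreeing_def)
  then show ?thesis by (auto simp: displaced_def in_set_conv_nth)
qed

text \<open>Iterates stay in the class of the starting path, at the expected distance, once the class is large enough
  to contain all the steps.\<close>
lemma adic_power_displaced:
  assumes \<gamma>: "\<gamma> \<in> paths" and "adic_power \<xi> k \<gamma> = Some \<eta>"
  shows "\<exists>N. \<forall>n\<ge>N. displaced \<xi> \<gamma> k \<eta> n"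
proof (cases "k \<ge> 0")
  case True
  have "((\<lambda>p. Option.bind p (adic \<xi>)) ^^ n) (Some \<gamma>) = Some \<eta> \<Longrightarrow>
    \<exists>N. \<forall>m\<ge>N. displaced \<xi> \<gamma> (int n) \<eta> m" for n
  proof (induction n arbitrary: \<eta>)
    case 0 then show ?case using displaced_self[OF \<gamma>] by auto
  next
    case (Suc n)
    then obtain \<zeta> where \<zeta>: "((\<lambda>p. Option.bind p (adic \<xi>)) ^^ n) (Some \<gamma>) = Some \<zeta>" "adic \<xi> \<zeta> = Some \<eta>"
      by (auto simp: Option.bind_eq_Some_conv)
    from Suc.IH[OF \<zeta>(1)] obtain N where N: "\<forall>m\<ge>N. displaced \<xi> \<gamma> (int n) \<zeta> m" by blast
    then have "\<zeta> \<in> agreeing \<gamma> N" using displaced_agreeing[OF \<gamma>] by blast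
    from adic_SomeD[OF \<gamma> this \<zeta>(2)] obtain M where M: "\<And>n. n \<ge> M \<Longrightarrow> \<exists>i. Suc i < length (class_list \<xi> \<gamma> n) \<and>
      class_list \<xi> \<gamma> n ! i = \<zeta> \<and> class_list \<xi> \<gamma> n ! Suc i = \<eta>" by blast
    have "\<exists>N. \<forall>m\<ge>N. displaced \<xi> \<gamma> (int n + 1) \<eta> m"
    proof (rule displaced_step[OF \<gamma> N], rule exI[of _ M], intro allI impI, goal_cases)
      case (1 m)
      from M[OF this] obtain i where i: "Suc i < length (class_list \<xi> \<gamma> m)"
        "class_list \<xi> \<gamma> m ! i = \<zeta>" "class_list \<xi> \<gamma> m ! Suc i = \<eta>" by blast
      then show ?case by (intro exI[of _ i] exI[of _ "Suc i"]) auto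
    qed
    then show ?case by (simp add: add.commute)
  qed
  from this[of "nat k"] True assms(2) show ?thesis by (simp add: adic_power_def)
next
  case False
  have "((\<lambda>p. Option.bind p (adic_inv \<xi>)) ^^ n) (Some \<gamma>) = Some \<eta> \<Longrightarrow>
    \<exists>N. \<forall>m\<ge>N. displaced \<xi> \<gamma> (- int n) \<eta> m" for n
  proof (induction n arbitrary: \<eta>)
    case 0 then show ?case using displaced_self[OF \<gamma>] by auto
  next
    case (Suc n)
    then obtain \<zeta> where \<zeta>: "((\<lambda>p. Option.bind p (adic_inv \<xi>)) ^^ n) (Some \<gamma>) = Some \<zeta>" "adic_inv \<xi> \<zeta> = Some \<eta>"
      by (auto simp: Option.bind_eq_Some_conv)
    from Suc.IH[OF \<zeta>(1)] obtain N where N: "\<forall>m\<ge>N. displaced \<xi> \<gamma> (- int n) \<zeta> m" by blast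
    then have "\<zeta> \<in> agreeing \<gamma> N" using displaced_agreeing[OF \<gamma>] by blast
    from adic_inv_SomeD[OF \<gamma> this \<zeta>(2)] obtain M where M: "\<And>n. n \<ge> M \<Longrightarrow> \<exists>i. Suc i < length (class_list \<xi> \<gamma> n) \<and>
      class_list \<xi> \<gamma> n ! i = \<eta> \<and> class_list \<xi> \<gamma> n ! Suc i = \<zeta>" by blast
    have "\<exists>N. \<forall>m\<ge>N. displaced \<xi> \<gamma> (- int n + - 1) \<eta> m"
    proof (rule displaced_step[OF \<gamma> N], rule exI[of _ M], intro allI impI, goal_cases)
      case (1 m)
      from M[OF this] obtain i where i: "Suc i < length (class_list \<xi> \<gamma> m)"
        "class_list \<xi> \<gamma> m ! i = \<eta>" "class_list \<xi> \<gamma> m ! Suc i = \<zeta>" by blast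
      then show ?case by (intro exI[of _ "Suc i"] exI[of _ i]) auto
    qed
    then show ?case by (simp add: add.commute)
  qed
  from this[of "nat (-k)"] False assms(2) show ?thesis by (simp add: adic_power_def)
qed

definition window :: "(int \<Rightarrow> letter) \<Rightarrow> int \<Rightarrow> nat \<Rightarrow> letter list" where
  "window s i l = map (\<lambda>j. s (i + int j)) [0..<l]"

lemma length_window [simp]: "length (window s i l) = l"
  by (simp add: window_def)

lemma nth_window [simp]: "j < l \<Longrightarrow> window s i l ! j = s (i + int j)"
  by (simp add: window_def)

text \<open>A finite stretch of an orbit lies in a single class list, at consecutive positions.\<close>
lemma coded_word_in_block:
  assumes \<gamma>: "\<gamma> \<in> paths" and cod: "\<forall>j<l. one_coding \<xi> \<gamma> (k + int j) = Some (w ! j)"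
    and l: "length w = l"
  shows "\<exists>x y. sublist w (block \<xi> x y)"
proof (cases "l = 0")
  case True then show ?thesis using l by auto
next
  case False
  have "\<forall>j\<in>{..<l}. \<exists>\<eta> N. first_letter \<eta> = w ! j \<and> (\<forall>n\<ge>N. displaced \<xi> \<gamma> (k + int j) \<eta> n)"
    using cod adic_power_displaced[OF \<gamma>] by (fastforce simp: one_coding_def)
  then obtain \<eta> N where \<eta>: "\<And>j. j < l \<Longrightarrow> first_letter (\<eta> j) = w ! j"
    and N: "\<And>j n. j < l \<Longrightarrow> n \<ge> N j \<Longrightarrow> displaced \<xi> \<gamma> (k + int j) (\<eta> j) n"
    by (metis lessThan_iff)
  \<comment> \<open>The sum bounds every \<open>N j\<close>; the successor keeps away from the root, where the block is empty.\<close>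
  define n where "n = Suc (\<Sum>j<l. N j)"
  have d: "displaced \<xi> \<gamma> (k + int j) (\<eta> j) n" if "j < l" for j
  proof -
    have "N j \<le> n" unfolding n_def using that by (intro le_SucI member_le_sum) auto
    then show ?thesis using N that by blast
  qed
  let ?xs = "class_list \<xi> \<gamma> n"
  obtain i where i: "i < length ?xs" "?xs ! i = \<gamma>"
    using displaced_self[OF \<gamma>] unfolding displaced_def by blast
  have q: "\<exists>q. q < length ?xs \<and> ?xs ! q = \<eta> j \<and> int q = int i + k + int j" if j: "j < l" for j
  proof -
    obtain i' q where "i' < length ?xs" "q < length ?xs" "?xs ! i' = \<gamma>" "?xs ! q = \<eta> j"
      "int q = int i' + (k + int j)" using d[OF j] unfolding displaced_def by blast
    moreover from this i have "i' = i" using class_list_inject[OF \<gamma>] by metis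
    ultimately show ?thesis by auto
  qed
  obtain p where p: "int p = int i + k" using q[of 0] False by auto
  have q': "p + j < length ?xs \<and> ?xs ! (p + j) = \<eta> j" if j: "j < l" for j
  proof -
    obtain q where "q < length ?xs" "?xs ! q = \<eta> j" "int q = int i + k + int j" using q[OF j] by blast
    moreover from this p have "q = p + j" by linarith
    ultimately show ?thesis by simp
  qed
  have len: "p + l \<le> length ?xs" using q'[of "l - 1"] False by linarith
  have "w = map first_letter (take l (drop p ?xs))"
    using l len q' \<eta> by (intro nth_equalityI) auto
  then have "sublist w (map first_letter ?xs)"
    by (metis map_mono_sublist sublist_drop sublist_order.order.trans sublist_take)
  moreover have "fst (\<gamma> n) \<noteq> (0, 0)" using path_level[OF \<gamma>, of n] by (auto simp: n_def)
  ultimately show ?thesis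
    using map_first_letter_tail_class[of "fst (fst (\<gamma> n))" "snd (fst (\<gamma> n))" \<xi> \<gamma>]
    unfolding class_list_def by (metis prod.collapse)
qed

lemma exists_path_to: "\<exists>\<gamma>\<in>paths. fst (\<gamma> (x + y)) = (x, y)"
proof -
  \<comment> \<open>From \<open>(x, y)\<close> on, always increase the first coordinate.\<close>
  have "tail_from x y (\<lambda>n. ((n - y, y), (Suc (n - y), y)))"
    by (auto simp: tail_from_def pascal_edges_def Suc_diff_le)
  then obtain \<gamma> where "\<gamma> \<in> agreeing (\<lambda>n. ((n - y, y), (Suc (n - y), y))) (x + y)"
    using tail_from_agreeing_nonempty by blast
  then show ?thesis by (auto simp: agreeing_def intro!: bexI[of _ \<gamma>])
qed

lemma block_word_coded:
  assumes "sublist w (block \<xi> x y)"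
  shows "\<exists>\<gamma>\<in>paths. \<forall>j<length w. one_coding \<xi> \<gamma> (int j) = Some (w ! j)"
proof (cases "w = []")
  case True then show ?thesis using exists_path_to by fastforce
next
  case False
  then have xy: "(x, y) \<noteq> (0, 0)" using assms by (cases "x = 0 \<and> y = 0") auto
  obtain \<gamma> where \<gamma>: "\<gamma> \<in> paths" "fst (\<gamma> (x + y)) = (x, y)" using exists_path_to by blast
  let ?xs = "class_list \<xi> \<gamma> (x + y)"
  have m: "map first_letter ?xs = block \<xi> x y"
    using \<gamma> map_first_letter_tail_class[OF xy] by (simp add: class_list_def)
  obtain us vs where usvs: "block \<xi> x y = us @ w @ vs" using assms by (auto simp: sublist_def)
  then have len: "length ?xs = length us + length w + length vs"
    using arg_cong[OF m, of length] by simp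
  have nth: "first_letter (?xs ! (length us + j)) = w ! j" if "j < length w" for j
  proof -
    have "first_letter (?xs ! (length us + j)) = map first_letter ?xs ! (length us + j)"
      using that len by simp
    also have "\<dots> = w ! j" unfolding m usvs using that by (simp add: nth_append)
    finally show ?thesis .
  qed
  have "length us < length ?xs" using len False by simp
  then have "?xs ! length us \<in> paths" using class_list_nth_mem[OF \<gamma>(1)] by (auto simp: agreeing_def)
  moreover have pow: "adic_power \<xi> (int j) (?xs ! length us) = Some (?xs ! (length us + j))"
    if "j < length w" for j
    using that
  proof (induction j)
    case 0 then show ?case by (simp add: adic_power_def)
  next
    case (Suc j)
    moreover have "nat (1 + int j) = Suc j" by simp
    ultimately show ?case using adic_nth[OF \<gamma>(1), of "length us + j" \<xi> "x + y"] len
      by (simp add: adic_power_def)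
  qed
  have "\<forall>j<length w. one_coding \<xi> (?xs ! length us) (int j) = Some (w ! j)"
    unfolding one_coding_def by (simp add: pow nth)
  ultimately show ?thesis by blast
qed

text \<open>This replaces the dynamics by the language of factors of blocks; everything below uses
  \<open>Sigma_shift\<close> only through it.\<close>
lemma Sigma_shift_iff: "s \<in> Sigma_shift \<xi> \<longleftrightarrow> (\<forall>i l. \<exists>x y. sublist (window s i l) (block \<xi> x y))"
proof
  assume s: "s \<in> Sigma_shift \<xi>"
  show "\<forall>i l. \<exists>x y. sublist (window s i l) (block \<xi> x y)"
  proof (intro allI)
    fix i l
    obtain \<gamma> k where "\<gamma> \<in> paths" "\<forall>j<l. one_coding \<xi> \<gamma> (k + int j) = Some (s (i + int j))"
      using s unfolding Sigma_shift_def by blast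
    then show "\<exists>x y. sublist (window s i l) (block \<xi> x y)"
      by (intro coded_word_in_block[of \<gamma> l \<xi> k]) auto
  qed
next
  assume s: "\<forall>i l. \<exists>x y. sublist (window s i l) (block \<xi> x y)"
  show "s \<in> Sigma_shift \<xi>" unfolding Sigma_shift_def
  proof (intro CollectI allI)
    fix i l
    obtain x y where "sublist (window s i l) (block \<xi> x y)" using s by blast
    from block_word_coded[OF this] obtain \<gamma> where "\<gamma> \<in> paths"
      "\<forall>j<l. one_coding \<xi> \<gamma> (int j) = Some (s (i + int j))" by auto
    then show "\<exists>\<gamma>\<in>paths. \<exists>k. \<forall>j<l. one_coding \<xi> \<gamma> (k + int j) = Some (s (i + int j))"
      by (metis add_0)
  qed
qed

section \<open>Exchanging the two letters\<close>

fun flip :: "letter \<Rightarrow> letter" where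
  "flip a = b" | "flip b = a"

lemma flip_flip [simp]: "flip (flip c) = c"
  by (cases c) auto

lemma flip_eq_iff [simp]: "flip c = a \<longleftrightarrow> c = b" "flip c = b \<longleftrightarrow> c = a"
  by (cases c; simp)+

lemma block_flip: "block (\<lambda>(u, v). \<not> \<xi> (v, u)) y x = map flip (block \<xi> x y)"
  by (induction \<xi> x y rule: block.induct) auto

lemma Sigma_shift_flip:
  assumes "s \<in> Sigma_shift \<xi>"
  shows "flip \<circ> s \<in> Sigma_shift (\<lambda>(u, v). \<not> \<xi> (v, u))"
  unfolding Sigma_shift_iff
proof (intro allI)
  fix i l
  obtain x y where "sublist (window s i l) (block \<xi> x y)" using assms Sigma_shift_iff by blast
  then have "sublist (map flip (window s i l)) (map flip (block \<xi> x y))" by (rule map_mono_sublist)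
  moreover have "map flip (window s i l) = window (flip \<circ> s) i l" by (simp add: window_def)
  ultimately show "\<exists>x y. sublist (window (flip \<circ> s) i l) (block (\<lambda>(u, v). \<not> \<xi> (v, u)) x y)"
    by (metis block_flip)
qed

section \<open>Words avoided by the constant ordering\<close>

abbreviation lex_block :: "nat \<Rightarrow> nat \<Rightarrow> letter list" where
  "lex_block \<equiv> block (\<lambda>_. True)"

lemma lex_block_first_row: "lex_block x (Suc 0) = b # replicate x a"
  by (induction x) (auto simp: replicate_append_same)

lemma lex_block_first_column: "lex_block (Suc 0) y = replicate y b @ [a]"
  by (induction y) auto

text \<open>The right factor of a block has the same first coordinate and the left factor the same second
  one, so the end of a block is governed by its first coordinate and the beginning by its second.\<close>
lemma suffix_lex_block: "suffix (b # replicate x a) (lex_block x (Suc y))"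
proof (induction y)
  case 0 then show ?case by (simp add: lex_block_first_row)
next
  case (Suc y) then show ?case by (cases x) (auto intro: suffix_appendI)
qed

lemma prefix_lex_block: "prefix (replicate y b @ [a]) (lex_block (Suc x) y)"
proof (induction x)
  case 0 then show ?case by (simp add: lex_block_first_column)
next
  case (Suc x)
  have "\<exists>zs. lex_block (Suc (Suc x)) y = lex_block (Suc x) y @ zs" by (cases y) auto
  with Suc show ?case by (metis prefix_prefix)
qed

text \<open>A suffix that contains a \<open>b\<close> reveals the first coordinate, and a prefix that contains an
  \<open>a\<close> reveals the second one.\<close>
lemma suffix_lex_block_last_run:
  assumes "suffix (p @ b # replicate k a) (lex_block x (Suc y))"
  shows "k = x"
proof -
  obtain u v where "u @ b # replicate k a = v @ b # replicate x a"
    using assms suffix_lex_block[of x y] unfolding suffix_def by (metis append.assoc)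
  then have "takeWhile (\<lambda>c. c = a) (rev (u @ b # replicate k a)) =
      takeWhile (\<lambda>c. c = a) (rev (v @ b # replicate x a))" by simp
  then have "replicate k a = replicate x a" by (simp add: takeWhile_append)
  then show ?thesis by (metis length_replicate)
qed

lemma prefix_lex_block_first_run:
  assumes "prefix (replicate k b @ a # q) (lex_block (Suc x) y)"
  shows "k = y"
proof -
  obtain u v where "replicate k b @ a # u = replicate y b @ a # v"
    using assms prefix_lex_block[of y x] unfolding prefix_def
    by (metis append.assoc append_Cons append_Nil)
  then have "takeWhile (\<lambda>c. c = b) (replicate k b @ a # u) =
      takeWhile (\<lambda>c. c = b) (replicate y b @ a # v)" by simp
  then have "replicate k b = replicate y b" by (simp add: takeWhile_append)
  then show ?thesis by (metis length_replicate)
qed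

lemma suffix_lex_block_b:
  assumes "suffix (p @ [b]) (lex_block x (Suc y))"
  shows "p = []"
proof -
  have "x = 0" using suffix_lex_block_last_run[of p 0] assms by simp
  with assms show ?thesis by simp
qed

lemma prefix_lex_block_a:
  assumes "prefix (a # q) (lex_block (Suc x) y)"
  shows "q = []"
proof -
  have "y = 0" using prefix_lex_block_first_run[of 0 q] assms by simp
  with assms show ?thesis by simp
qed

text \<open>An occurrence in a block of least size straddles the seam between its two factors.\<close>
lemma not_sublist_lex_blockI:
  assumes "length w \<ge> 2"
    and "\<And>x y p q. w = p @ q \<Longrightarrow> p \<noteq> [] \<Longrightarrow> q \<noteq> [] \<Longrightarrow> suffix p (lex_block x (Suc y)) \<Longrightarrow>
      prefix q (lex_block (Suc x) y) \<Longrightarrow> False"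
  shows "\<not> sublist w (lex_block x y)"
proof (induction "\<lambda>_::vertex. True" x y rule: block.induct)
  case (4 x y)
  show ?case
  proof
    assume "sublist w (lex_block (Suc x) (Suc y))"
    then have "sublist w (lex_block x (Suc y) @ lex_block (Suc x) y)" by simp
    with 4 obtain p q where "w = p @ q" "suffix p (lex_block x (Suc y))"
      "prefix q (lex_block (Suc x) y)" by (auto simp: sublist_append)
    with 4 assms(2) show False by (cases "p = [] \<or> q = []") auto
  qed
qed (use assms(1) in \<open>auto dest: sublist_length_le\<close>)

lemma lex_block_avoids_bbaa: "\<not> sublist [b, b, a, a] (lex_block x y)"
proof (rule not_sublist_lex_blockI)
  fix x y p q assume w: "[b, b, a, a] = p @ q" and ne: "p \<noteq> []" "q \<noteq> []"
    and p: "suffix p (lex_block x (Suc y))" and q: "prefix q (lex_block (Suc x) y)"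
  from w ne consider "p = [b]" "q = [b, a, a]" | "p = [b] @ [b]" | "p = [b, b, a]" "q = [a]"
    by (auto simp: Cons_eq_append_conv)
  then show False
  proof cases
    case 1
    then have "x = 0" "y = 1"
      using suffix_lex_block_last_run[of "[]" 0] prefix_lex_block_first_run[of 1 "[a]"] p q by auto
    with 1 q show False by simp
  next
    case 2 then show False using suffix_lex_block_b p by blast
  next
    case 3
    then have "x = 1" "y = 0"
      using suffix_lex_block_last_run[of "[b]" 1] prefix_lex_block_first_run[of 0 "[]"] p q by auto
    with 3 p show False by (auto dest: suffix_length_le)
  qed
qed simp

lemma lex_block_avoids_aababb: "\<not> sublist [a, a, b, a, b, b] (lex_block x y)"
proof (rule not_sublist_lex_blockI)
  fix x y p q assume w: "[a, a, b, a, b, b] = p @ q" and ne: "p \<noteq> []" "q \<noteq> []"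
    and p: "suffix p (lex_block x (Suc y))" and q: "prefix q (lex_block (Suc x) y)"
  from w ne consider "q = a # [b, a, b, b]" | "q = [b, a, b, b]" | "p = [a, a] @ [b]"
    | "p = [a, a, b, a]" | "p = [a, a, b, a] @ [b]"
    by (auto simp: Cons_eq_append_conv)
  then show False
  proof cases
    case 1 then show False using prefix_lex_block_a q by blast
  next
    case 2
    then have "y = 1" using prefix_lex_block_first_run[of 1 "[b, b]"] q by auto
    with 2 q show False by (cases x) (auto simp: lex_block_first_row)
  next
    case 3 then show False using suffix_lex_block_b p by blast
  next
    case 4
    then have "x = 1" using suffix_lex_block_last_run[of "[a, a]" 1] p by auto
    with 4 p have "suffix ([a, a, b] @ [a]) (replicate (Suc y) b @ [a])"
      by (simp only: lex_block_first_column One_nat_def) simp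
    then have "suffix ([a, a] @ [b]) (replicate (Suc y) b)" by (simp add: snoc_suffix_snoc del: replicate_Suc)
    then have "a \<in> set (replicate (Suc y) b)" by (metis append_Cons list.set_intros(1) set_mono_suffix subsetD)
    then show False by simp
  next
    case 5 then show False using suffix_lex_block_b p by blast
  qed
qed simp

text \<open>The three places where a word \<open>a\<^sup>n b r\<close> can be cut. The first alternative is impossible
  at a seam, by \<open>prefix_lex_block_a\<close>.\<close>
lemma append_eq_run_append:
  assumes "p @ q = replicate n a @ b # r"
  obtains q' where "q = a # q'" "q' \<noteq> []" | "p = replicate n a" "q = b # r"
    | p' where "p = replicate n a @ b # p'" "p' @ q = r"
proof -
  have "(\<exists>q'. q = a # q' \<and> q' \<noteq> []) \<or> (p = replicate n a \<and> q = b # r) \<or>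
    (\<exists>p'. p = replicate n a @ b # p' \<and> p' @ q = r)"
    using assms
  proof (induction n arbitrary: p)
    case 0 then show ?case by (cases p) auto
  next
    case (Suc n) then show ?case by (cases p) auto
  qed
  with that show ?thesis by blast
qed

text \<open>The only cut compatible with the ends of the blocks is \<open>a\<^sup>n b a\<^sup>n | b a\<close>, at the
  vertex \<open>(n + 1, 2)\<close>. There the left factor ends with \<open>b a\<^bsup>n-1\<^esup> b a\<^sup>n\<close>:
  in the row \<open>y = 2\<close> the gaps between successive \<open>b\<close> strictly increase, so two equal ones do
  not follow each other.\<close>
lemma lex_block_avoids_equal_gaps:
  assumes "n > 0"
  shows "\<not> sublist (replicate n a @ b # replicate n a @ [b, a]) (lex_block x y)"
proof (rule not_sublist_lex_blockI)
  fix x y p q assume w: "replicate n a @ b # replicate n a @ [b, a] = p @ q"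
    and ne: "p \<noteq> []" "q \<noteq> []"
    and p: "suffix p (lex_block x (Suc y))" and q: "prefix q (lex_block (Suc x) y)"
  have no_a: "q \<noteq> a # q'" if "q' \<noteq> []" for q' using prefix_lex_block_a q that by blast
  obtain m where m: "n = Suc m" using assms by (cases n) auto
  from w[symmetric] show False
  proof (cases rule: append_eq_run_append)
    case (1 q') then show ?thesis using no_a by blast
  next
    case 2
    then have "q = replicate 1 b @ a # replicate m a @ [b, a]" using m by simp
    then have "y = 1" using prefix_lex_block_first_run q by metis
    with q have "prefix (a # replicate m a @ [b, a]) (replicate (Suc x) a)"
      using 2 m by (simp only: One_nat_def lex_block_first_row) simp
    then have "b \<in> set (replicate (Suc x) a)" by (auto dest: set_mono_prefix)
    then show False by simp
  next
    case (3 p')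
    from 3(2) have "p' @ q = replicate n a @ b # [a]" by simp
    then show ?thesis
    proof (cases rule: append_eq_run_append)
      case (1 q') then show ?thesis using no_a by blast
    next
      case 2
      have "x = n" using suffix_lex_block_last_run[of "replicate n a" n x y] p 3(1) 2(1) by simp
      have "y = 1" using prefix_lex_block_first_run[of 1 "[]"] q 2(2) by auto
      have "lex_block n (Suc (Suc 0)) = lex_block m (Suc (Suc 0)) @ b # replicate n a"
        using m lex_block_first_row[of n] by simp
      then have "suffix (replicate n a) (lex_block m (Suc (Suc 0)))"
        using p 3(1) 2(1) \<open>x = n\<close> \<open>y = 1\<close> by simp
      moreover have "suffix (b # replicate m a) (lex_block m (Suc (Suc 0)))"
        by (rule suffix_lex_block)
      ultimately have "suffix (replicate n a) (b # replicate m a)"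
        by (rule suffix_length_suffix) (simp add: m)
      then have "replicate n a = b # replicate m a" by (auto simp: suffix_Cons m dest: suffix_length_le)
      then show ?thesis by (simp add: m)
    next
      case (3 p'')
      then have "p = (replicate n a @ b # replicate n a) @ [b]"
        using ne \<open>p = replicate n a @ b # p'\<close> by (cases p'') auto
      then show ?thesis using suffix_lex_block_b p by blast
    qed
  qed
qed simp

section \<open>Sequences avoiding these words\<close>

lemma window_add: "window s i (k + l) = window s i k @ window s (i + int k) l"
  unfolding window_def upt_add_eq_append[of 0 k l, simplified] map_append
  by (rule arg_cong[where f = "\<lambda>zs. _ @ zs"]) (rule nth_equalityI, auto simp: algebra_simps)

lemma window_eqI:
  assumes "length w = l" "\<And>j. j < l \<Longrightarrow> s (i + int j) = w ! j"
  shows "window s i l = w"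
  using assms by (intro nth_equalityI) auto

lemma Sigma_avoid:
  assumes "s \<in> Sigma_shift (\<lambda>_. True)"
  shows "\<not> (s i = b \<and> s (i + 1) = b \<and> s (i + 2) = a \<and> s (i + 3) = a)"
    and "\<not> (s i = a \<and> s (i + 1) = a \<and> s (i + 2) = b \<and> s (i + 3) = a \<and> s (i + 4) = b \<and> s (i + 5) = b)"
    and "n > 0 \<Longrightarrow> window s i (2 * n + 3) \<noteq> replicate n a @ b # replicate n a @ [b, a]"
proof -
  have sub: "\<exists>x y. sublist (window s i l) (lex_block x y)" for l
    using assms Sigma_shift_iff by blast
  have upt: "[0..<4] = [0, 1, 2, 3]" "[0..<6] = [0, 1, 2, 3, 4, 5]" by (simp_all add: upt_rec)
  show "\<not> (s i = b \<and> s (i + 1) = b \<and> s (i + 2) = a \<and> s (i + 3) = a)"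
    using sub[of 4] lex_block_avoids_bbaa by (auto simp: window_def upt)
  show "\<not> (s i = a \<and> s (i + 1) = a \<and> s (i + 2) = b \<and> s (i + 3) = a \<and> s (i + 4) = b \<and> s (i + 5) = b)"
    using sub[of 6] lex_block_avoids_aababb by (auto simp: window_def upt)
  show "window s i (2 * n + 3) \<noteq> replicate n a @ b # replicate n a @ [b, a]" if "n > 0"
    using sub[of "2 * n + 3"] lex_block_avoids_equal_gaps[OF that] by auto
qed

lemma flip_comp_flip [simp]: "flip \<circ> (flip \<circ> s) = s"
  by (simp add: fun_eq_iff)

context
  fixes s :: "int \<Rightarrow> letter"
  assumes s: "s \<in> Sigma_shift (\<lambda>_. True)" and flip_s: "flip \<circ> s \<in> Sigma_shift (\<lambda>_. True)"
begin

lemma no_aabb: "\<not> (s i = a \<and> s (i + 1) = a \<and> s (i + 2) = b \<and> s (i + 3) = b)"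
  using Sigma_avoid(1)[OF flip_s] by simp

lemma no_ababa: "\<not> (s i = a \<and> s (i + 1) = b \<and> s (i + 2) = a \<and> s (i + 3) = b \<and> s (i + 4) = a)"
  using Sigma_avoid(3)[OF s, of 1 i] by (auto simp: window_def upt_rec)

lemma no_babab: "\<not> (s i = b \<and> s (i + 1) = a \<and> s (i + 2) = b \<and> s (i + 3) = a \<and> s (i + 4) = b)"
  using Sigma_avoid(3)[OF flip_s, of 1 i] by (auto simp: window_def upt_rec)

text \<open>Since \<open>ababa\<close> and \<open>babab\<close> are avoided, \<open>abab\<close> could only occur
  inside \<open>aababb\<close>.\<close>
lemma no_abab: "\<not> (s i = a \<and> s (i + 1) = b \<and> s (i + 2) = a \<and> s (i + 3) = b)"
proof
  assume abab: "s i = a \<and> s (i + 1) = b \<and> s (i + 2) = a \<and> s (i + 3) = b"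
  have "s (i - 1) = a"
    using no_babab[of "i - 1"] abab by (cases "s (i - 1)") (auto simp: algebra_simps)
  moreover have "s (i + 4) = b" using no_ababa[of i] abab by (cases "s (i + 4)") auto
  ultimately show False
    using Sigma_avoid(2)[OF s, of "i - 1"] abab by (simp add: algebra_simps)
qed

text \<open>To the right of \<open>aa\<close> each \<open>b\<close> is preceded by \<open>aa\<close>: the alternatives
  \<open>aabb\<close> and \<open>abab\<close> are avoided.\<close>
lemma no_bb_after_aa:
  assumes "s i = a" "s (i + 1) = a" "i \<le> k"
  shows "\<not> (s k = b \<and> s (k + 1) = b)"
proof -
  have inv: "s (i + 2 + int m) = b \<longrightarrow> s (i + 1 + int m) = a \<and> s (i + int m) = a" for m
  proof (induction m rule: less_induct)
    case (less m)
    show ?case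
    proof
      assume m: "s (i + 2 + int m) = b"
      have 1: "s (i + 1 + int m) = a"
      proof (rule ccontr)
        assume "s (i + 1 + int m) \<noteq> a"
        then have bb: "s (i + 1 + int m) = b" by (cases "s (i + 1 + int m)") auto
        with assms obtain m' where m': "m = Suc m'" by (cases m) auto
        from less[of m'] bb m' have "s (i + 1 + int m') = a \<and> s (i + int m') = a"
          by (simp add: algebra_simps)
        with bb m m' no_aabb[of "i + int m'"] show False by (simp add: algebra_simps)
      qed
      moreover have "s (i + int m) = a"
      proof (rule ccontr)
        assume "s (i + int m) \<noteq> a"
        then have bb: "s (i + int m) = b" by (cases "s (i + int m)") auto
        have "m \<noteq> 0" by (rule notI) (use bb assms in simp)
        moreover have "m \<noteq> 1" by (rule notI) (use bb assms in simp)
        ultimately obtain m' where m': "m = Suc (Suc m')" by (metis One_nat_def not0_implies_Suc)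
        from less[of m'] bb m' have "s (i + 1 + int m') = a" by (simp add: algebra_simps)
        with bb m m' 1 no_abab[of "i + 1 + int m'"] show False by (simp add: algebra_simps)
      qed
      ultimately show "s (i + 1 + int m) = a \<and> s (i + int m) = a" ..
    qed
  qed
  show ?thesis
  proof
    assume bb: "s k = b \<and> s (k + 1) = b"
    then have "k \<noteq> i" using assms by auto
    with assms have "int (nat (k - i - 1)) = k - i - 1" by simp
    with inv[of "nat (k - i - 1)"] bb show False by (simp add: algebra_simps)
  qed
qed

end

lemma no_aa_or_no_bb:
  assumes "s \<in> Sigma_shift (\<lambda>_. True)" "flip \<circ> s \<in> Sigma_shift (\<lambda>_. True)"
  shows "(\<forall>i. \<not> (s i = a \<and> s (i + 1) = a)) \<or> (\<forall>i. \<not> (s i = b \<and> s (i + 1) = b))"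
proof (rule ccontr)
  assume "\<not> ?thesis"
  then obtain i k where i: "s i = a" "s (i + 1) = a" and k: "s k = b" "s (k + 1) = b" by blast
  have "\<not> i \<le> k" using no_bb_after_aa[OF assms i] k by blast
  moreover have "\<not> k \<le> i"
    using no_bb_after_aa[of "flip \<circ> s" k i] assms i k by auto
  ultimately show False by linarith
qed

text \<open>Take two \<open>b\<close> at minimal distance \<open>d = n + 1\<close>. By minimality the \<open>n\<close>
  letters between them and the \<open>n\<close> letters before the first are all \<open>a\<close>, and an
  \<open>a\<close> follows the second, which produces the avoided word \<open>a\<^sup>n b a\<^sup>n b a\<close>.\<close>
lemma isolated_b_unique:
  assumes s: "s \<in> Sigma_shift (\<lambda>_. True)" and no_bb: "\<forall>i. \<not> (s i = b \<and> s (i + 1) = b)"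
    and "s i = b" "s j = b"
  shows "i = j"
proof (rule ccontr)
  assume "i \<noteq> j"
  define P where "P = (\<lambda>d. d > 0 \<and> (\<exists>i. s i = b \<and> s (i + int d) = b))"
  have "P (nat \<bar>j - i\<bar>)"
  proof (cases "i < j")
    case True then show ?thesis using assms by (auto simp: P_def intro!: exI[of _ i])
  next
    case False then show ?thesis using assms \<open>i \<noteq> j\<close> by (auto simp: P_def intro!: exI[of _ j])
  qed
  define d where "d = (LEAST d. P d)"
  have Pd: "P d" unfolding d_def using \<open>P (nat \<bar>j - i\<bar>)\<close> by (rule LeastI)
  have min: "s (k + int e) = a" if "s k = b" "0 < e" "e < d" for k e
  proof (rule ccontr)
    assume "s (k + int e) \<noteq> a"
    then have "s (k + int e) = b" by (cases "s (k + int e)") auto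
    then have "P e" using that by (auto simp: P_def)
    then show False using not_less_Least[of e P] that by (simp add: d_def)
  qed
  from Pd obtain c where c: "s c = b" "s (c + int d) = b" "d > 0" by (auto simp: P_def)
  have "d \<noteq> 1" using c no_bb by auto
  define n where "n = d - 1"
  have n: "n > 0" "d = Suc n" using c(3) \<open>d \<noteq> 1\<close> by (auto simp: n_def)
  have left: "s (c - int e) = a" if "0 < e" "e < d" for e
  proof (rule ccontr)
    assume "s (c - int e) \<noteq> a"
    then have "s (c - int e) = b" by (cases "s (c - int e)") auto
    from min[OF this that] c(1) show False by simp
  qed
  have after: "s (c + int d + 1) = a"
    using no_bb c(2) by (cases "s (c + int d + 1)") auto
  have "window s (c - int n) (2 * n + 3) = replicate n a @ b # replicate n a @ [b, a]"
  proof (rule window_eqI)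
    fix j assume "j < 2 * n + 3"
    then consider "j < n" | "j = n" | "n < j" "j < n + d" | "j = n + d" | "j = n + d + 1"
      using n by linarith
    then show "s (c - int n + int j) = (replicate n a @ b # replicate n a @ [b, a]) ! j"
    proof cases
      case 1
      then show ?thesis using left[of "n - j"] n by (simp add: nth_append of_nat_diff algebra_simps)
    next
      case 2 then show ?thesis using c by (simp add: nth_append)
    next
      case 3
      define e where "e = j - n - 1"
      have j: "j = n + Suc e" "e < n" using 3 n by (auto simp: e_def)
      then show ?thesis using min[OF c(1), of "Suc e"] n by (simp add: nth_append algebra_simps)
    next
      case 4 then show ?thesis using c n by (simp add: nth_append algebra_simps)
    next
      case 5 then show ?thesis using after n by (simp add: nth_append algebra_simps)
    qed
  qed simp
  with Sigma_avoid(3)[OF s n(1)] show False by blast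
qed

lemma shift_orbit_point: "shift_orbit ((\<lambda>_. x)(0 := y)) = range (\<lambda>c. (\<lambda>_. x)(c := y))"
proof (intro equalityI subsetI)
  fix t assume "t \<in> shift_orbit ((\<lambda>_. x)(0 := y))"
  then obtain k where "t = (\<lambda>i. ((\<lambda>_. x)(0 := y)) (i + k))" by (auto simp: shift_orbit_def)
  then have "t = (\<lambda>_. x)(- k := y)" by (auto simp: fun_eq_iff)
  then show "t \<in> range (\<lambda>c. (\<lambda>_. x)(c := y))" by blast
next
  fix t :: "int \<Rightarrow> letter" assume "t \<in> range (\<lambda>c. (\<lambda>_. x)(c := y))"
  then obtain c where "t = (\<lambda>_. x)(c := y)" by blast
  then have "t = (\<lambda>i. ((\<lambda>_. x)(0 := y)) (i + (- c)))" by (auto simp: fun_eq_iff)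
  then show "t \<in> shift_orbit ((\<lambda>_. x)(0 := y))" unfolding shift_orbit_def by blast
qed

lemma no_bb_cases:
  assumes "s \<in> Sigma_shift (\<lambda>_. True)" and "\<forall>i. \<not> (s i = b \<and> s (i + 1) = b)"
  shows "s = (\<lambda>_. a) \<or> (\<exists>c. s = (\<lambda>_. a)(c := b))"
proof (cases "\<exists>c. s c = b")
  case True
  then obtain c where c: "s c = b" by blast
  have "s i = ((\<lambda>_. a)(c := b)) i" for i
    using isolated_b_unique[OF assms, of i c] c by (cases "s i") auto
  then show ?thesis by (auto simp: fun_eq_iff)
next
  case False
  then have "s i = a" for i by (cases "s i") auto
  then show ?thesis by (auto simp: fun_eq_iff)
qed

section \<open>Words occurring for every ordering\<close>

text \<open>The number of letters \<open>a\<close> before the only \<open>b\<close> of the block at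
  \<open>(x, 1)\<close>.\<close>
fun lead :: "ordering \<Rightarrow> nat \<Rightarrow> nat" where
  "lead \<xi> 0 = 0"
| "lead \<xi> (Suc x) = (if \<xi> (Suc x, Suc 0) then lead \<xi> x else Suc (lead \<xi> x))"

lemma lead_le: "lead \<xi> x \<le> x"
  by (induction x) auto

lemma lead_mono: "x \<le> y \<Longrightarrow> lead \<xi> x \<le> lead \<xi> y"
  by (induction y rule: dec_induct) auto

lemma lead_diff_mono: "x \<le> y \<Longrightarrow> x - lead \<xi> x \<le> y - lead \<xi> y"
  by (induction y rule: dec_induct) auto

lemma block_first_row:
  "block \<xi> x (Suc 0) = replicate (lead \<xi> x) a @ b # replicate (x - lead \<xi> x) a"
  by (induction x) (auto simp: Suc_diff_le lead_le replicate_append_same)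

text \<open>Passing from \<open>(x, 2)\<close> to \<open>(x + 3, 2)\<close> attaches three blocks of the row
  \<open>y = 1\<close>, each on the left or on the right. Two of them go to the same side, and these become
  neighbours.\<close>
lemma adjacent_first_row_blocks:
  "\<exists>i\<in>{x<..x + 3}. \<exists>j\<in>{x<..x + 3}.
     sublist (block \<xi> i (Suc 0) @ block \<xi> j (Suc 0)) (block \<xi> (x + 3) (Suc (Suc 0)))"
proof -
  let ?W = "\<lambda>i. block \<xi> i (Suc 0)" and ?B = "\<lambda>i. block \<xi> i (Suc (Suc 0))"
  have step: "?B (Suc i) = ?B i @ ?W (Suc i) \<or> ?B (Suc i) = ?W (Suc i) @ ?B i" for i by simp
  define w1 w2 w3 where "w1 = ?W (x + 1)" "w2 = ?W (x + 2)" "w3 = ?W (x + 3)"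
  note w = this
  have mem: "x + 1 \<in> {x<..x + 3}" "x + 2 \<in> {x<..x + 3}" "x + 3 \<in> {x<..x + 3}" by auto
  have "sublist (w1 @ w2) (?B (x + 3)) \<or> sublist (w2 @ w3) (?B (x + 3)) \<or>
    sublist (w2 @ w1) (?B (x + 3)) \<or> sublist (w3 @ w2) (?B (x + 3)) \<or>
    sublist (w1 @ w3) (?B (x + 3)) \<or> sublist (w3 @ w1) (?B (x + 3))"
  proof -
    have "?B (x + 1) = ?B x @ w1 \<or> ?B (x + 1) = w1 @ ?B x"
      "?B (x + 2) = ?B (x + 1) @ w2 \<or> ?B (x + 2) = w2 @ ?B (x + 1)"
      "?B (x + 3) = ?B (x + 2) @ w3 \<or> ?B (x + 3) = w3 @ ?B (x + 2)"
      using step[of x] step[of "x + 1"] step[of "x + 2"] unfolding w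
      by (simp_all only: add_Suc_right[symmetric] Suc_eq_plus1 add.assoc one_add_one) (simp_all add: numeral_3_eq_3 numeral_2_eq_2)
    moreover have "sublist (u @ v) (u @ v @ q)" "sublist (u @ v) (p @ u @ v)"
      "sublist (u @ v) (p @ u @ v @ q)" "sublist (u @ v) (p @ q @ u @ v)" for p q u v :: "letter list"
      by (metis append.assoc sublist_appendI sublist_append_leftI sublist_append_rightI)+
    ultimately show ?thesis by (elim disjE) simp_all
  qed
  then show ?thesis unfolding w using mem by blast
qed

lemma sublist_padded:
  assumes "m \<le> p" "m \<le> q"
  shows "sublist (replicate m a @ b # replicate m a) (replicate p a @ b # replicate q a)"
proof -
  obtain p' q' where "p = p' + m" "q = m + q'"
    using assms by (metis add.commute le_Suc_ex)
  then have "replicate p a @ b # replicate q a =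
    replicate p' a @ (replicate m a @ b # replicate m a) @ replicate q' a"
    by (simp add: replicate_add)
  then show ?thesis by (metis sublist_appendI)
qed

text \<open>If the leading run at \<open>2m + 3\<close> is shorter than \<open>m\<close>, then for
  \<open>2m < x\<close> up to there all trailing runs have length at least \<open>m\<close>, so a product of two such
  blocks has a long enough run on both sides of its second \<open>b\<close>; if the trailing run is short, the first
  \<open>b\<close> of the product serves instead.\<close>
lemma isolated_b_in_block: "\<exists>x y. sublist (replicate m a @ b # replicate m a) (block \<xi> x y)"
proof -
  let ?w = "replicate m a @ b # replicate m a"
  let ?N = "2 * m + 3"
  consider "m \<le> lead \<xi> ?N" "m \<le> ?N - lead \<xi> ?N" | "lead \<xi> ?N < m" | "?N - lead \<xi> ?N < m"
    by linarith
  then show ?thesis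
  proof cases
    case 1
    then have "sublist ?w (block \<xi> ?N (Suc 0))" unfolding block_first_row by (rule sublist_padded)
    then show ?thesis by blast
  next
    case 2
    obtain i j where ij: "i \<in> {2 * m<..?N}" "j \<in> {2 * m<..?N}"
      "sublist (block \<xi> i (Suc 0) @ block \<xi> j (Suc 0)) (block \<xi> ?N (Suc (Suc 0)))"
      using adjacent_first_row_blocks by blast
    have "lead \<xi> i < m" "lead \<xi> j < m"
      using lead_mono[of i ?N \<xi>] lead_mono[of j ?N \<xi>] ij 2 by auto
    then have "sublist ?w (replicate (i - lead \<xi> i + lead \<xi> j) a @ b # replicate (j - lead \<xi> j) a)"
      using ij by (intro sublist_padded) auto
    moreover have "block \<xi> i (Suc 0) @ block \<xi> j (Suc 0) = (replicate (lead \<xi> i) a @ [b]) @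
      (replicate (i - lead \<xi> i + lead \<xi> j) a @ b # replicate (j - lead \<xi> j) a)"
      by (simp add: block_first_row replicate_add)
    ultimately have "sublist ?w (block \<xi> i (Suc 0) @ block \<xi> j (Suc 0))"
      using sublist_order.order.trans[OF _ sublist_append_leftI] by (simp only:)
    with ij show ?thesis by (blast intro: sublist_order.order.trans)
  next
    case 3
    obtain i j where ij: "i \<in> {2 * m<..?N}" "j \<in> {2 * m<..?N}"
      "sublist (block \<xi> i (Suc 0) @ block \<xi> j (Suc 0)) (block \<xi> ?N (Suc (Suc 0)))"
      using adjacent_first_row_blocks by blast
    have "i - lead \<xi> i < m" "j - lead \<xi> j < m"
      using lead_diff_mono[of i ?N \<xi>] lead_diff_mono[of j ?N \<xi>] ij 3 by auto
    then have "sublist ?w (replicate (lead \<xi> i) a @ b # replicate (i - lead \<xi> i + lead \<xi> j) a)"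
      using ij by (intro sublist_padded) auto
    moreover have "block \<xi> i (Suc 0) @ block \<xi> j (Suc 0) =
      (replicate (lead \<xi> i) a @ b # replicate (i - lead \<xi> i + lead \<xi> j) a) @
      (b # replicate (j - lead \<xi> j) a)"
      by (simp add: block_first_row replicate_add)
    ultimately have "sublist ?w (block \<xi> i (Suc 0) @ block \<xi> j (Suc 0))"
      using sublist_order.order.trans[OF _ sublist_append_rightI] by (simp only:)
    with ij show ?thesis by (blast intro: sublist_order.order.trans)
  qed
qed

lemma const_a_in_Sigma: "(\<lambda>_. a) \<in> Sigma_shift \<xi>"
  unfolding Sigma_shift_iff
proof (intro allI)
  fix i l
  obtain x y where "sublist (replicate l a @ b # replicate l a) (block \<xi> x y)"
    using isolated_b_in_block by blast
  moreover have "window (\<lambda>_. a) i l = replicate l a" by (rule window_eqI) auto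
  ultimately show "\<exists>x y. sublist (window (\<lambda>_. a) i l) (block \<xi> x y)"
    by (metis sublist_append_rightI sublist_order.order.trans)
qed

lemma point_b_in_Sigma: "(\<lambda>_. a)(c := b) \<in> Sigma_shift \<xi>"
  unfolding Sigma_shift_iff
proof (intro allI)
  fix i l
  let ?s = "(\<lambda>_. a)(c := b)"
  \<comment> \<open>So large that the window of radius \<open>m\<close> around \<open>c\<close> contains the given one.\<close>
  define m where "m = nat \<bar>c - i\<bar> + l"
  define p where "p = nat (i - c + int m)"
  define r where "r = 2 * m + 1 - p - l"
  have pr: "p + (l + r) = 2 * m + 1" "c - int m + int p = i"
    by (auto simp: m_def p_def r_def)
  have "window ?s (c - int m) (2 * m + 1) = replicate m a @ b # replicate m a"
    by (rule window_eqI) (auto simp: nth_append nth_Cons split: nat.split)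
  then have "sublist (window ?s i l) (replicate m a @ b # replicate m a)"
    unfolding pr(1)[symmetric] window_add pr(2) by (metis sublist_appendI)
  then show "\<exists>x y. sublist (window ?s i l) (block \<xi> x y)"
    using isolated_b_in_block by (blast intro: sublist_order.order.trans)
qed

lemma Inter_Sigma_flip:
  assumes "s \<in> (\<Inter>\<xi>. Sigma_shift \<xi>)"
  shows "flip \<circ> s \<in> (\<Inter>\<xi>. Sigma_shift \<xi>)"
proof
  fix \<xi>
  have "flip \<circ> s \<in> Sigma_shift (\<lambda>(u, v). \<not> (\<lambda>(u, v). \<not> \<xi> (v, u)) (v, u))"
    using assms by (intro Sigma_shift_flip) blast
  then show "flip \<circ> s \<in> Sigma_shift \<xi>" by simp
qed

theorem theorem6p9:
  "(\<Inter>\<xi>. Sigma_shift \<xi>) =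
     {(\<lambda>_. a), (\<lambda>_. b)}
     \<union> shift_orbit ((\<lambda>_. a)(0 := b))
     \<union> shift_orbit ((\<lambda>_. b)(0 := a))"
  (is "?I = ?S")
proof
  have flip_point: "flip \<circ> (\<lambda>_::int. a) = (\<lambda>_. b)" "flip \<circ> (\<lambda>_. a)(c := b) = (\<lambda>_. b)(c := a)" for c :: int
    by (auto simp: fun_eq_iff)
  have 1: "(\<lambda>_. a) \<in> ?I" and 2: "(\<lambda>_. a)(c := b) \<in> ?I" for c
    using const_a_in_Sigma point_b_in_Sigma by blast+
  have 3: "(\<lambda>_. b) \<in> ?I" and 4: "(\<lambda>_. b)(c := a) \<in> ?I" for c
    using Inter_Sigma_flip[OF 1] Inter_Sigma_flip[OF 2] by (simp_all only: flip_point)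
  have "{u, v} \<union> range f \<union> range g \<subseteq> I"
    if "u \<in> I" "v \<in> I" "\<And>c. f c \<in> I" "\<And>c. g c \<in> I" for I u v and f g :: "int \<Rightarrow> int \<Rightarrow> letter"
    using that by blast
  from this[OF 1 3 2 4] show "?S \<subseteq> ?I" unfolding shift_orbit_point .
  show "?I \<subseteq> ?S"
  proof
    fix s assume s: "s \<in> ?I"
    have 1: "s \<in> Sigma_shift (\<lambda>_. True)" and 2: "flip \<circ> s \<in> Sigma_shift (\<lambda>_. True)"
      using s Inter_Sigma_flip[OF s] by blast+
    from no_aa_or_no_bb[OF 1 2] show "s \<in> ?S"
    proof
      assume "\<forall>i. \<not> (s i = a \<and> s (i + 1) = a)"
      then have "flip \<circ> s = (\<lambda>_. a) \<or> (\<exists>c. flip \<circ> s = (\<lambda>_. a)(c := b))"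
        by (intro no_bb_cases[OF 2]) simp
      then have "flip \<circ> (flip \<circ> s) = (\<lambda>_. b) \<or> (\<exists>c. flip \<circ> (flip \<circ> s) = (\<lambda>_. b)(c := a))"
        using flip_point by metis
      then show ?thesis unfolding shift_orbit_point flip_comp_flip by blast
    next
      assume "\<forall>i. \<not> (s i = b \<and> s (i + 1) = b)"
      from no_bb_cases[OF 1 this] show ?thesis unfolding shift_orbit_point by blast
    qed
  qed
qed

end
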